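(* For all $t\in\mathbb{N}$, every polynomial $\chi$-bounding function for $\mathcal{B}_t$ has degree larger than $\frac{1}{2}\log_2 t$.
   Context: $\mathbb{N}$ denotes the set of all positive integers. Graphs have finite vertex sets, no loops, and no parallel edges. $\chi(G)$ and $\omega(G)$ denote the chromatic number and the clique number of a graph $G$. A bull is a graph obtained from a four-vertex path by adding a vertex adjacent to (exactly) the two middle vertices of the path. A graph $G$ is bull-free if no induced subgraph of $G$ is a bull. For $t\in\mathbb{N}$, $\mathcal{B}_t$ denotes the class of all bull-free graphs whose triangle-free induced subgraphs have chromatic number at most $t$. A polynomial $\chi$-bounding function for a graph class $\mathcal{C}$ is a polynomial function $f:\mathbb{N}\to\mathbb{N}$ such that $\chi(G)\leq f(\omega(G))$ for every $G\in\mathcal{C}$.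
   Formalization: The formal theorem assumes t ≥ 2: at t = 1 the class consists of the edgeless graphs, so the constant function 1 is a polynomial χ-bounding function of degree 0, which is not larger than (1/2) log_2 1 = 0. *)

theory Defs
  imports
    "Graph_Theory.Graph_Theory"
    "Graph_Theory.Kuratowski"
    "HOL-Computational_Algebra.Polynomial"
begin

text \<open>
  Finite simple graphs are the symmetric loopless digraphs of the locale \<open>pair_graph\<close>, with
  arcs given as pairs of vertices; the function \<open>with_proj\<close> (a declared coercion) views them as
  general digraphs.  Every undirected edge is represented by its two orientations.
\<close>

definition proper_colouring :: "'a pair_pre_digraph \<Rightarrow> nat \<Rightarrow> ('a \<Rightarrow> nat) \<Rightarrow> bool" where
  "proper_colouring G k c \<longleftrightarrow>
     c ` pverts G \<subseteq> {..<k} \<and> (\<forall>u v. (u, v) \<in> parcs G \<longrightarrow> c u \<noteq> c v)"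

definition chromatic_number :: "'a pair_pre_digraph \<Rightarrow> nat" where
  "chromatic_number G = (LEAST k. \<exists>c. proper_colouring G k c)"

definition clique_number :: "'a pair_pre_digraph \<Rightarrow> nat" where
  "clique_number G =
     Max {n. \<exists>H :: 'a pair_pre_digraph.
               induced_subgraph (with_proj H) (with_proj G) \<and> K\<^bsub>n\<^esub> (with_proj H)}"

definition triangle_free :: "'a pair_pre_digraph \<Rightarrow> bool" where
  "triangle_free G \<longleftrightarrow>
     \<not> (\<exists>H :: 'a pair_pre_digraph.
           induced_subgraph (with_proj H) (with_proj G) \<and> K\<^bsub>3\<^esub> (with_proj H))"

text \<open>The path 0-1-2-3 together with the vertex 4, which is adjacent to 1 and 2.\<close>

definition bull :: "nat pair_pre_digraph" where
  "bull = (let E = {(0, 1), (1, 2), (2, 3), (4, 1), (4, 2)}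
           in \<lparr> pverts = {0, 1, 2, 3, 4}, parcs = E \<union> E\<inverse> \<rparr>)"

definition bull_free :: "'a pair_pre_digraph \<Rightarrow> bool" where
  "bull_free G \<longleftrightarrow>
     \<not> (\<exists>H :: 'a pair_pre_digraph.
           induced_subgraph (with_proj H) (with_proj G) \<and>
           digraph_iso (with_proj H) (with_proj bull))"

text \<open>
  The vertices are natural numbers.  As every finite graph is isomorphic to one of this kind, this
  represents the class of all finite graphs with the stated property.
\<close>

definition bull_class :: "nat \<Rightarrow> nat pair_pre_digraph set" where
  "bull_class t =
     {G. pair_graph G \<and> bull_free G \<and>
         (\<forall>H :: nat pair_pre_digraph.
            induced_subgraph (with_proj H) (with_proj G) \<longrightarrow> triangle_free H \<longrightarrow>
            chromatic_number H \<le> t)}"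

text \<open>
  A function on the positive integers is represented by a function on \<open>nat\<close> whose value at 0 is
  irrelevant.  Accordingly nothing is required for the graph without vertices, the only graph whose
  clique number is 0.  An integer-valued polynomial function may have non-integral coefficients,
  and its degree is that of the real polynomial representing it, which is unique since the two agree
  at infinitely many points.
\<close>

definition polynomial_function :: "(nat \<Rightarrow> nat) \<Rightarrow> real poly \<Rightarrow> bool" where
  "polynomial_function f p \<longleftrightarrow> (\<forall>n\<ge>1. real (f n) = poly p (real n))"

definition chi_bounding :: "(nat \<Rightarrow> nat) \<Rightarrow> nat pair_pre_digraph set \<Rightarrow> bool" where
  "chi_bounding f C \<longleftrightarrow>
     (\<forall>n\<ge>1. f n \<ge> 1) \<and>
     (\<forall>G\<in>C. pverts G \<noteq> {} \<longrightarrow> chromatic_number G \<le> f (clique_number G))"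

text \<open>
  The class for \<open>t = 1\<close> consists of the edgeless graphs, so it has a constant chi-bounding function.
  Its degree is 0, which is not larger than half the logarithm of 1; hence a lower bound of this
  form can only hold from \<open>t = 2\<close> on.
\<close>

lemma bull_class_1_edgeless:
  assumes "G \<in> bull_class 1"
  shows "parcs G = {}"
proof (rule ccontr)
  assume "parcs G \<noteq> {}"
  then obtain u v where uv: "(u, v) \<in> parcs G" by auto
  interpret pair_graph G using assms by (simp add: bull_class_def)
  define H where
    "H = \<lparr> pverts = {u, v}, parcs = {e \<in> parcs G. fst e \<in> {u, v} \<and> snd e \<in> {u, v}} \<rparr>"
  have ind: "induced_subgraph (with_proj H) (with_proj G)"
    using uv in_arcsD1[OF uv] in_arcsD2[OF uv] wf_digraph
    by (auto simp: H_def induced_subgraph_def subgraph_def compatible_def wf_digraph_def)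
  have "triangle_free H"
    unfolding triangle_free_def
  proof safe
    fix K :: "nat pair_pre_digraph"
    assume K: "induced_subgraph (with_proj K) (with_proj H)" "K\<^bsub>3\<^esub> (with_proj K)"
    have "pverts K \<subseteq> {u, v}"
      using K(1) by (auto simp: induced_subgraph_def subgraph_def H_def)
    then have "card (pverts K) \<le> card {u, v}" by (intro card_mono) auto
    also have "\<dots> \<le> 2" by (simp add: card_insert_if)
    finally show False using K(2) by (simp add: complete_digraph_def)
  qed
  then have le: "chromatic_number H \<le> 1"
    using assms ind by (auto simp: bull_class_def)
  obtain c where c: "bij_betw c (pverts H) {0..<card (pverts H)}"
    using ex_bij_betw_finite_nat[of "pverts H"] by (auto simp: H_def)
  have "u \<noteq> v" using pair_no_loops[OF uv] by simp
  then have "proper_colouring H (card (pverts H)) c"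
    using c pair_no_loops unfolding proper_colouring_def
    by (fastforce simp: bij_betw_def inj_on_def H_def)
  then have "\<exists>c. proper_colouring H (chromatic_number H) c"
    unfolding chromatic_number_def by (intro LeastI[where P = "\<lambda>k. \<exists>c. proper_colouring H k c"]) auto
  then obtain d where d: "proper_colouring H (chromatic_number H) d" ..
  then have "d u \<noteq> d v" "d u < chromatic_number H" "d v < chromatic_number H"
    using uv by (auto simp: proper_colouring_def H_def)
  with le show False by simp
qed

lemma bull_class_1_constant_chi_bounding:
  "polynomial_function (\<lambda>_. 1) 1" "chi_bounding (\<lambda>_. 1) (bull_class 1)"
proof -
  have "proper_colouring G 1 (\<lambda>_. 0)" if "G \<in> bull_class 1" for G
    using bull_class_1_edgeless[OF that] by (auto simp: proper_colouring_def)
  then show "chi_bounding (\<lambda>_. 1) (bull_class 1)"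
    unfolding chi_bounding_def chromatic_number_def by (auto intro: Least_le)
qed (simp add: polynomial_function_def)

end

theory Submission
  imports Defs "HOL-Library.Nat_Bijection"
begin

text \<open>
  Write \<open>x\<close> for the fractional chromatic number of a triangle-free graph \<open>G\<close> with a proper
  \<open>t\<close>-colouring. The lexicographic powers of \<open>G\<close> stay in the class for \<open>t\<close>: a bull has no
  nontrivial homogeneous set, and in a triangle-free induced subgraph of a product the fibre over a
  non-isolated vertex is independent. The \<open>n\<close>-th power has clique number at most \<open>2 ^ n\<close>, while
  its chromatic number is at least \<open>x ^ n\<close> because fractional cliques multiply. Hence a polynomial
  bounding function of degree \<open>d\<close> satisfies \<open>x \<le> 2 ^ d\<close>. Iterated Mycielskians provide \<open>G\<close>: each
  step costs one colour and replaces \<open>x\<close> by \<open>x + 1 / x\<close> (Larsen, Propp and Ullman), so \<open>x\<^sup>2\<close>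
  grows by more than \<open>2\<close> and exceeds \<open>t\<close>.
\<close>

section \<open>Graphs given by their arcs\<close>

lemma pair_graph_iff:
  "pair_graph G \<longleftrightarrow>
     finite (pverts G) \<and> parcs G \<subseteq> pverts G \<times> pverts G \<and> sym (parcs G) \<and> irrefl (parcs G)"
  (is "_ \<longleftrightarrow> ?R")
proof
  assume "pair_graph G"
  then interpret pair_graph G .
  have "symmetric (with_proj G)" by (rule pair_sym_arcs)
  then show ?R
    using pair_finite_verts arc_fst_in_verts arc_snd_in_verts pair_no_loops
    by (fastforce simp: symmetric_def irrefl_def)
next
  assume R: ?R
  then have "finite (parcs G)" by (auto intro: finite_subset)
  with R show "pair_graph G"
    by unfold_locales (auto simp: symmetric_def irrefl_def)
qed

text \<open>Well-formedness of \<open>H\<close> follows from the arc equation, so an induced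
  subgraph amounts to the choice of a vertex set.\<close>

lemma induced_subgraph_pair_iff:
  assumes "pair_graph G"
  shows "induced_subgraph (with_proj H) (with_proj G) \<longleftrightarrow>
    pverts H \<subseteq> pverts G \<and> parcs H = parcs G \<inter> pverts H \<times> pverts H"
proof -
  interpret pair_graph G by fact
  have "pair_wf_digraph G" ..
  moreover from this have "pair_wf_digraph H"
    if "parcs H = parcs G \<inter> pverts H \<times> pverts H"
    using that by (auto simp: pair_wf_digraph_def)
  ultimately show ?thesis
    unfolding induced_subgraph_def subgraph_def
    by (simp add: wf_digraph_wp_iff compatibleI_with_proj) (auto simp: mem_Times_iff)
qed

section \<open>Cliques, independent sets, triangles, colourings and bulls in terms of
  vertices\<close>

definition clique_in :: "'a pair_pre_digraph \<Rightarrow> 'a set \<Rightarrow> bool" where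
  "clique_in G S \<longleftrightarrow> S \<subseteq> pverts G \<and> (\<forall>u\<in>S. \<forall>v\<in>S. u \<noteq> v \<longrightarrow> (u, v) \<in> parcs G)"

definition independent_in :: "'a pair_pre_digraph \<Rightarrow> 'a set \<Rightarrow> bool" where
  "independent_in G S \<longleftrightarrow> S \<subseteq> pverts G \<and> (\<forall>u\<in>S. \<forall>v\<in>S. (u, v) \<notin> parcs G)"

definition triangle_free_on :: "'a pair_pre_digraph \<Rightarrow> 'a set \<Rightarrow> bool" where
  "triangle_free_on G W \<longleftrightarrow>
     (\<forall>a\<in>W. \<forall>b\<in>W. \<forall>c\<in>W. \<not> ((a, b) \<in> parcs G \<and> (b, c) \<in> parcs G \<and> (a, c) \<in> parcs G))"

definition colourable_on :: "'a pair_pre_digraph \<Rightarrow> 'a set \<Rightarrow> nat \<Rightarrow> bool" where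
  "colourable_on G W k \<longleftrightarrow>
     (\<exists>c. c ` W \<subseteq> {..<k} \<and> (\<forall>u\<in>W. \<forall>v\<in>W. (u, v) \<in> parcs G \<longrightarrow> c u \<noteq> c v))"

text \<open>Loops being excluded, the listed adjacencies force the five vertices to be distinct.\<close>

definition bull_at :: "'a pair_pre_digraph \<Rightarrow> 'a \<Rightarrow> 'a \<Rightarrow> 'a \<Rightarrow> 'a \<Rightarrow> 'a \<Rightarrow> bool" where
  "bull_at G a b c d e \<longleftrightarrow>
     (a, b) \<in> parcs G \<and> (b, c) \<in> parcs G \<and> (c, d) \<in> parcs G \<and> (e, b) \<in> parcs G \<and>
     (e, c) \<in> parcs G \<and> (a, c) \<notin> parcs G \<and> (a, d) \<notin> parcs G \<and> (b, d) \<notin> parcs G \<and>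
     (a, e) \<notin> parcs G \<and> (d, e) \<notin> parcs G"

text \<open>\<open>Max\<close> is informative only for a finite nonempty set: the bound
  \<open>m\<close> provides finiteness, and a single vertex, a clique of size 1, provides the
  element.\<close>

lemma clique_number_bounds:
  assumes G: "pair_graph G" and ne: "pverts G \<noteq> {}"
    and le: "\<And>S. clique_in G S \<Longrightarrow> card S \<le> m"
  shows "1 \<le> clique_number G" "clique_number G \<le> m"
proof -
  define N where "N = {n. \<exists>H :: 'a pair_pre_digraph.
    induced_subgraph (with_proj H) (with_proj G) \<and> K\<^bsub>n\<^esub> (with_proj H)}"
  have N_le: "n \<le> m" if "n \<in> N" for n
  proof -
    from that obtain H :: "'a pair_pre_digraph"
      where H: "induced_subgraph (with_proj H) (with_proj G)" "K\<^bsub>n\<^esub> (with_proj H)"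
      by (auto simp: N_def)
    then have "clique_in G (pverts H)" "card (pverts H) = n"
      using G by (auto simp: induced_subgraph_pair_iff complete_digraph_pair_def clique_in_def)
    with le show ?thesis by blast
  qed
  then have fin: "finite N" by (auto simp: finite_nat_set_iff_bounded_le)
  from ne obtain v where v: "v \<in> pverts G" by blast
  define H where "H = \<lparr> pverts = {v}, parcs = {} \<rparr>"
  have "induced_subgraph (with_proj H) (with_proj G)" "K\<^bsub>1\<^esub> (with_proj H)"
    using G v
    by (auto simp: induced_subgraph_pair_iff H_def complete_digraph_pair_def
          pair_graph_iff irrefl_def)
  then have "1 \<in> N" by (auto simp: N_def)
  then have "1 \<le> Max N" "Max N \<in> N" using fin by (auto intro: Max_in)
  then show "1 \<le> clique_number G" "clique_number G \<le> m"
    using N_le by (auto simp: clique_number_def N_def)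
qed

lemma bull_freeI:
  assumes G: "pair_graph G" and nb: "\<And>a b c d e. \<not> bull_at G a b c d e"
  shows "bull_free G"
  unfolding bull_free_def
proof safe
  fix H :: "'a pair_pre_digraph"
  assume H: "induced_subgraph (with_proj H) (with_proj G)"
    and iso: "digraph_iso (with_proj H) (with_proj bull)"
  from iso obtain h where h: "pre_digraph.digraph_isomorphism (with_proj H) h"
    and eq: "with_proj bull = app_iso h (with_proj H)"
    unfolding digraph_iso_def by blast
  define f where "f = iso_verts h"
  have inj: "inj_on f (pverts H)"
    using h by (simp add: pre_digraph.digraph_isomorphism_def f_def)
  have verts: "f ` pverts H = pverts bull"
    using arg_cong[OF eq, of verts] by (simp add: f_def)
  have arcs: "iso_arcs h ` parcs H = parcs bull"
    using arg_cong[OF eq, of arcs] by simp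
  \<comment> \<open>The digraph of the bull has \<open>fst\<close> and \<open>snd\<close> as tail
    and head maps; hence the arc map of the isomorphism is induced by its vertex map.\<close>
  have tail: "iso_tail h = fst" and head: "iso_head h = snd"
    using arg_cong[OF eq, of tail] arg_cong[OF eq, of head] by simp_all
  have H_arcs: "parcs H = parcs G \<inter> pverts H \<times> pverts H"
    using H G by (simp add: induced_subgraph_pair_iff)
  have "iso_arcs h e = (f (fst e), f (snd e))" if "e \<in> parcs H" for e
    using h that by (simp add: pre_digraph.digraph_isomorphism_def f_def tail head prod_eq_iff)
  then have "parcs bull = map_prod f f ` parcs H"
    unfolding arcs[symmetric] by (intro image_cong) (auto simp: map_prod_def)
  then have adj: "(u, v) \<in> parcs G \<longleftrightarrow> (f u, f v) \<in> parcs bull"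
    if "u \<in> pverts H" "v \<in> pverts H" for u v
    using that inj H_arcs by (auto simp: inj_on_def) metis
  define g where "g = inv_into (pverts H) f"
  have g: "g i \<in> pverts H \<and> f (g i) = i" if "i \<in> {0, 1, 2, 3, 4}" for i
  proof -
    have "i \<in> f ` pverts H" using that unfolding verts by (simp add: bull_def)
    then show ?thesis by (simp add: g_def inv_into_into f_inv_into_f)
  qed
  have "bull_at G (g 0) (g 1) (g 2) (g 3) (g 4)"
    by (simp add: bull_at_def adj g) (simp add: bull_def)
  with nb show False by blast
qed

lemma chromatic_number_le:
  assumes "colourable_on G (pverts G) k" "pair_graph G"
  shows "chromatic_number G \<le> k"
proof -
  obtain c where c: "c ` pverts G \<subseteq> {..<k}"
    "\<And>u v. u \<in> pverts G \<Longrightarrow> v \<in> pverts G \<Longrightarrow> (u, v) \<in> parcs G \<Longrightarrow> c u \<noteq> c v"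
    using assms(1) unfolding colourable_on_def by metis
  have "c u \<noteq> c v" if "(u, v) \<in> parcs G" for u v
    using assms(2) that by (intro c(2)) (auto simp: pair_graph_iff)
  then have "proper_colouring G k c"
    using c(1) by (simp add: proper_colouring_def)
  then show ?thesis
    unfolding chromatic_number_def by (intro Least_le exI)
qed

text \<open>The least number is attained as soon as some proper colouring exists, and an injective
  numbering of the vertices is one.\<close>

lemma proper_colouring_chromatic_number:
  assumes "pair_graph G"
  shows "\<exists>c. proper_colouring G (chromatic_number G) c"
  unfolding chromatic_number_def
proof (rule LeastI)
  interpret pair_graph G by fact
  obtain c where c: "bij_betw c (pverts G) {0..<card (pverts G)}"
    using ex_bij_betw_finite_nat[OF pair_finite_verts] by blast
  have "c u \<noteq> c v" if "(u, v) \<in> parcs G" for u v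
    using c that in_arcsD1[OF that] in_arcsD2[OF that] no_loops'[OF that]
    by (auto simp: bij_betw_def dest: inj_onD)
  then show "\<exists>c. proper_colouring G (card (pverts G)) c"
    using c unfolding proper_colouring_def bij_betw_def
    by (intro exI[of _ c] conjI allI impI) auto
qed

lemma triangle_free_iff:
  assumes G: "pair_graph G"
  shows "triangle_free G \<longleftrightarrow> triangle_free_on G (pverts G)"
proof
  assume free: "triangle_free G"
  show "triangle_free_on G (pverts G)"
    unfolding triangle_free_on_def
  proof (intro ballI notI)
    fix a b c
    assume V: "a \<in> pverts G" "b \<in> pverts G" "c \<in> pverts G"
      and E: "(a, b) \<in> parcs G \<and> (b, c) \<in> parcs G \<and> (a, c) \<in> parcs G"
    define H where "H = \<lparr> pverts = {a, b, c}, parcs = parcs G \<inter> {a, b, c} \<times> {a, b, c} \<rparr>"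
    have ne: "a \<noteq> b" "b \<noteq> c" "a \<noteq> c"
      using E G by (auto simp: pair_graph_iff irrefl_def)
    have "induced_subgraph (with_proj H) (with_proj G)"
      using V G by (simp add: induced_subgraph_pair_iff H_def)
    moreover have "K\<^bsub>3\<^esub> (with_proj H)"
      using E ne G
      by (auto simp: H_def complete_digraph_pair_def pair_graph_iff irrefl_def dest: symD)
    ultimately show False using free by (auto simp: triangle_free_def)
  qed
next
  assume free: "triangle_free_on G (pverts G)"
  show "triangle_free G"
    unfolding triangle_free_def
  proof safe
    fix H :: "'a pair_pre_digraph"
    assume H: "induced_subgraph (with_proj H) (with_proj G)" "K\<^bsub>3\<^esub> (with_proj H)"
    then obtain a b c where "pverts H = {a, b, c}" "a \<noteq> b" "b \<noteq> c" "a \<noteq> c"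
      by (auto simp: complete_digraph_pair_def card_3_iff)
    moreover from this have "(a, b) \<in> parcs H" "(b, c) \<in> parcs H" "(a, c) \<in> parcs H"
      using H(2) by (simp_all add: complete_digraph_pair_def)
    moreover have "parcs H \<subseteq> parcs G" "pverts H \<subseteq> pverts G"
      using H(1) G by (simp_all add: induced_subgraph_pair_iff)
    ultimately show False using free unfolding triangle_free_on_def by blast
  qed
qed

text \<open>This membership criterion speaks only of vertices and vertex sets, so the constructions
  below need not handle induced subgraphs or isomorphisms.\<close>

lemma bull_classI:
  assumes G: "pair_graph G" and nb: "\<And>a b c d e. \<not> bull_at G a b c d e"
    and col: "\<And>W. W \<subseteq> pverts G \<Longrightarrow> triangle_free_on G W \<Longrightarrow> colourable_on G W t"
  shows "G \<in> bull_class t"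
proof -
  have "chromatic_number H \<le> t"
    if H: "induced_subgraph (with_proj H) (with_proj G)" and free: "triangle_free H" for H
  proof -
    have HG: "pverts H \<subseteq> pverts G" "parcs H = parcs G \<inter> pverts H \<times> pverts H"
      using H G by (simp_all add: induced_subgraph_pair_iff)
    with G have pg: "pair_graph H"
      by (auto simp: pair_graph_iff irrefl_def finite_subset intro!: symI dest: symD)
    have "triangle_free_on G (pverts H)"
      using free HG(2) unfolding triangle_free_iff[OF pg] triangle_free_on_def by blast
    from col[OF HG(1) this] obtain c where "c ` pverts H \<subseteq> {..<t}"
      "\<forall>u\<in>pverts H. \<forall>v\<in>pverts H. (u, v) \<in> parcs G \<longrightarrow> c u \<noteq> c v"
      unfolding colourable_on_def by (elim exE conjE)
    then have "colourable_on H (pverts H) t"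
      using HG(2) unfolding colourable_on_def by (intro exI[of _ c]) simp
    then show ?thesis using pg by (rule chromatic_number_le)
  qed
  then show ?thesis
    using bull_freeI[OF G nb] G by (simp add: bull_class_def)
qed

section \<open>Fractional cliques and fractional colourings\<close>

text \<open>The weights are a feasible point of the linear program dual to fractional colouring, so
  \<open>x\<close> is a lower bound for the fractional chromatic number.\<close>

definition fractional_clique :: "'a pair_pre_digraph \<Rightarrow> real \<Rightarrow> bool" where
  "fractional_clique G x \<longleftrightarrow>
     (\<exists>w :: 'a \<Rightarrow> real. (\<forall>v. 0 \<le> w v) \<and> sum w (pverts G) = x \<and>
        (\<forall>S. independent_in G S \<longrightarrow> sum w S \<le> 1))"

text \<open>
  By linear programming duality this says that the fractional chromatic number is at most \<open>x\<close>;
  stated in this dual form, no distribution on the independent sets has to be exhibited.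
\<close>

definition fractionally_colourable :: "'a pair_pre_digraph \<Rightarrow> real \<Rightarrow> bool" where
  "fractionally_colourable G x \<longleftrightarrow>
     (\<forall>w :: 'a \<Rightarrow> real. (\<forall>v. 0 \<le> w v) \<longrightarrow>
        (\<exists>S. independent_in G S \<and> sum w (pverts G) \<le> x * sum w S))"

text \<open>The colour classes of an optimal colouring are independent, so each contributes at most
  1 to the total weight.\<close>

lemma fractional_clique_le_chromatic_number:
  assumes G: "pair_graph G" and clique: "fractional_clique G x"
  shows "x \<le> chromatic_number G"
proof -
  obtain c where c: "proper_colouring G (chromatic_number G) c"
    using proper_colouring_chromatic_number[OF G] by blast
  obtain w where w: "sum w (pverts G) = x" "\<And>S. independent_in G S \<Longrightarrow> sum w S \<le> 1"
    using clique by (auto simp: fractional_clique_def)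
  have "x = (\<Sum>i<chromatic_number G. sum w {v \<in> pverts G. c v = i})"
    using c G unfolding w(1)[symmetric]
    by (intro sum.group[symmetric]) (auto simp: pair_graph_iff proper_colouring_def)
  also have "\<dots> \<le> (\<Sum>i<chromatic_number G. 1)"
    using c unfolding proper_colouring_def
    by (intro sum_mono w(2)) (auto simp: independent_in_def, metis)
  finally show ?thesis by simp
qed

text \<open>Starting point of both inductions, over Mycielskians and over lexicographic
  powers.\<close>

lemma single_vertex_graph:
  fixes v :: 'a
  defines "G \<equiv> \<lparr> pverts = {v}, parcs = {} \<rparr>"
  shows "pair_graph G" "fractional_clique G 1" "fractionally_colourable G 1"
proof -
  show "pair_graph G" by (simp add: G_def pair_graph_iff irrefl_def sym_def)
  have ind: "independent_in G S \<longleftrightarrow> S \<subseteq> {v}" for S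
    by (auto simp: independent_in_def G_def)
  have "(\<Sum>_\<in>S. 1 :: real) \<le> 1" if "S \<subseteq> {v}" for S
    using card_mono[OF _ that] by simp
  then show "fractional_clique G 1"
    unfolding fractional_clique_def ind by (intro exI[of _ "\<lambda>_. 1"]) (simp add: G_def)
  show "fractionally_colourable G 1"
    unfolding fractionally_colourable_def ind
    by (intro allI impI exI[of _ "{v}"]) (simp add: G_def)
qed

section \<open>The Mycielskian\<close>

text \<open>The Mycielskian again lives on natural numbers: 0 is the apex, odd numbers are originals
  and positive even numbers are twins.\<close>

definition original :: "nat \<Rightarrow> nat" where "original v = Suc (2 * v)"
definition twin :: "nat \<Rightarrow> nat" where "twin v = Suc (Suc (2 * v))"

lemma original_twin_simps [simp]:
  "original u = original v \<longleftrightarrow> u = v" "twin u = twin v \<longleftrightarrow> u = v"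
  "original u \<noteq> twin v" "twin v \<noteq> original u"
  "original v \<noteq> 0" "twin v \<noteq> 0" "0 \<noteq> original v" "0 \<noteq> twin v"
  unfolding original_def twin_def by presburger+

definition mycielskian :: "nat pair_pre_digraph \<Rightarrow> nat pair_pre_digraph" where
  "mycielskian G =
     \<lparr> pverts = insert 0 (original ` pverts G \<union> twin ` pverts G),
       parcs = {(original u, original v) | u v. (u, v) \<in> parcs G} \<union>
               {(original u, twin v) | u v. (u, v) \<in> parcs G} \<union>
               {(twin u, original v) | u v. (u, v) \<in> parcs G} \<union>
               {(0, twin v) | v. v \<in> pverts G} \<union> {(twin v, 0) | v. v \<in> pverts G} \<rparr>"

lemma pverts_mycielskian:
  "pverts (mycielskian G) = insert 0 (original ` pverts G \<union> twin ` pverts G)"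
  by (simp add: mycielskian_def)

lemma parcs_mycielskian [simp]:
  "(original u, original v) \<in> parcs (mycielskian G) \<longleftrightarrow> (u, v) \<in> parcs G"
  "(original u, twin v) \<in> parcs (mycielskian G) \<longleftrightarrow> (u, v) \<in> parcs G"
  "(twin u, original v) \<in> parcs (mycielskian G) \<longleftrightarrow> (u, v) \<in> parcs G"
  "(twin u, twin v) \<notin> parcs (mycielskian G)"
  "(0, twin v) \<in> parcs (mycielskian G) \<longleftrightarrow> v \<in> pverts G"
  "(twin v, 0) \<in> parcs (mycielskian G) \<longleftrightarrow> v \<in> pverts G"
  "(0, original v) \<notin> parcs (mycielskian G)"
  "(original v, 0) \<notin> parcs (mycielskian G)"
  "(0, 0) \<notin> parcs (mycielskian G)"
  by (auto simp: mycielskian_def)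

lemma pair_graph_mycielskian:
  assumes "pair_graph G" shows "pair_graph (mycielskian G)"
  using assms unfolding pair_graph_iff
  by (auto simp: mycielskian_def irrefl_def intro!: symI dest: symD)

text \<open>Twins are pairwise nonadjacent and the apex is adjacent only to twins. A triangle thus
  avoids the apex and has at most one twin; replacing it by its original gives a triangle of
  \<open>G\<close>.\<close>

lemma triangle_free_mycielskian:
  assumes free: "triangle_free_on G (pverts G)"
  shows "triangle_free_on (mycielskian G) (pverts (mycielskian G))"
  unfolding triangle_free_on_def pverts_mycielskian
proof (intro ballI)
  fix a b c
  assume "a \<in> insert 0 (original ` pverts G \<union> twin ` pverts G)"
    "b \<in> insert 0 (original ` pverts G \<union> twin ` pverts G)"
    "c \<in> insert 0 (original ` pverts G \<union> twin ` pverts G)"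
  then show "\<not> ((a, b) \<in> parcs (mycielskian G) \<and> (b, c) \<in> parcs (mycielskian G) \<and>
      (a, c) \<in> parcs (mycielskian G))"
    by (elim insertE UnE imageE; simp) (use free in \<open>unfold triangle_free_on_def, blast\<close>)+
qed

lemma colourable_mycielskian:
  assumes "colourable_on G (pverts G) k"
  shows "colourable_on (mycielskian G) (pverts (mycielskian G)) (Suc k)"
proof -
  from assms obtain c where c: "c ` pverts G \<subseteq> {..<k}"
    "\<And>u v. u \<in> pverts G \<Longrightarrow> v \<in> pverts G \<Longrightarrow> (u, v) \<in> parcs G \<Longrightarrow> c u \<noteq> c v"
    unfolding colourable_on_def by blast
  \<comment> \<open>Twins inherit the colour of their originals and the apex gets the new colour
    \<open>k\<close>; \<open>(n - 1) div 2\<close> decodes both \<open>original v\<close> and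
    \<open>twin v\<close> to \<open>v\<close>.\<close>
  define d where "d n = (if n = 0 then k else c ((n - 1) div 2))" for n
  have d: "d 0 = k" "d (original v) = c v" "d (twin v) = c v" for v
    by (simp_all add: d_def original_def twin_def)
  show ?thesis
    unfolding colourable_on_def pverts_mycielskian
    using c by (intro exI[of _ d]) (auto simp: d less_Suc_eq)
qed

section \<open>Fractional colourings and fractional cliques of the Mycielskian\<close>

lemma sum_mycielskian:
  fixes w :: "nat \<Rightarrow> real"
  assumes "finite A" "finite B"
  shows "sum w (original ` A \<union> twin ` B) = (\<Sum>v\<in>A. w (original v)) + (\<Sum>v\<in>B. w (twin v))"
    and "sum w (insert 0 (original ` A \<union> twin ` B)) =
      w 0 + (\<Sum>v\<in>A. w (original v)) + (\<Sum>v\<in>B. w (twin v))"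
proof -
  show *: "sum w (original ` A \<union> twin ` B) = (\<Sum>v\<in>A. w (original v)) + (\<Sum>v\<in>B. w (twin v))"
    using assms by (subst sum.union_disjoint) (auto simp: sum.reindex inj_on_def)
  have "0 \<notin> original ` A \<union> twin ` B" by auto
  then show "sum w (insert 0 (original ` A \<union> twin ` B)) =
      w 0 + (\<Sum>v\<in>A. w (original v)) + (\<Sum>v\<in>B. w (twin v))"
    using assms * by (subst sum.insert) auto
qed

text \<open>
  The largest weight \<open>m\<close> of an independent set is compared with the three candidates
  \<open>original ` A \<union> {0}\<close>, \<open>original ` B \<union> twin ` B\<close> and the set of all twins;
  the three inequalities are then added with coefficients \<open>1\<close>, \<open>x - 1\<close> and \<open>1 / x\<close>.
\<close>

lemma fractionally_colourable_mycielskian: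
  assumes G: "pair_graph G" and x: "1 \<le> x" and col: "fractionally_colourable G x"
  shows "fractionally_colourable (mycielskian G) (x + 1 / x)"
  unfolding fractionally_colourable_def
proof (intro allI impI)
  fix w :: "nat \<Rightarrow> real"
  assume w: "\<forall>v. 0 \<le> w v"
  let ?M = "mycielskian G" and ?V = "pverts G"
  define a where "a = (\<Sum>v\<in>?V. w (original v))"
  define b where "b = (\<Sum>v\<in>?V. w (twin v))"
  have fin: "finite ?V" using G by (simp add: pair_graph_iff)
  obtain A where A: "independent_in G A" "a \<le> x * (\<Sum>v\<in>A. w (original v))"
    using col w unfolding fractionally_colourable_def a_def
    by (elim allE[of _ "\<lambda>v. w (original v)"]) auto
  \<comment> \<open>Originals and twins over an independent set are jointly independent, so
    \<open>B\<close> is chosen for the combined weight of each original and its twin.\<close>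
  obtain B where B: "independent_in G B"
    "a + b \<le> x * (\<Sum>v\<in>B. w (original v) + w (twin v))"
    using col w unfolding fractionally_colourable_def a_def b_def sum.distrib[symmetric]
    by (elim allE[of _ "\<lambda>v. w (original v) + w (twin v)"]) auto
  have finAB: "finite A" "finite B"
    using A(1) B(1) fin by (auto simp: independent_in_def finite_subset)
  define F where "F = Collect (independent_in ?M)"
  have "F \<subseteq> Pow (pverts ?M)" by (auto simp: F_def independent_in_def)
  then have finF: "finite F"
    using pair_graph_mycielskian[OF G] by (auto simp: pair_graph_iff intro: finite_subset)
  \<comment> \<open>The empty images bring the sets into the form to which
    \<open>sum_mycielskian\<close> applies.\<close>
  define S1 where "S1 = insert 0 (original ` A \<union> twin ` {})"
  define S2 where "S2 = original ` B \<union> twin ` B"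
  define S3 where "S3 = original ` {} \<union> twin ` ?V"
  have inF: "S1 \<in> F" "S2 \<in> F" "S3 \<in> F"
    using A(1) B(1)
    by (auto simp: F_def S1_def S2_def S3_def independent_in_def pverts_mycielskian)
  define m where "m = Max (sum w ` F)"
  have m_ge: "sum w S \<le> m" if "S \<in> F" for S
    using that finF by (simp add: m_def)
  have "m \<in> sum w ` F"
    unfolding m_def using inF finF by (intro Max_in) auto
  then obtain S where S: "S \<in> F" "m = sum w S" by blast
  have m1: "w 0 + (\<Sum>v\<in>A. w (original v)) \<le> m"
    using m_ge[OF inF(1)] finAB unfolding S1_def by (simp only: sum_mycielskian finite.emptyI) simp
  have m2: "(\<Sum>v\<in>B. w (original v) + w (twin v)) \<le> m"
    using m_ge[OF inF(2)] finAB unfolding S2_def by (simp only: sum_mycielskian sum.distrib)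
  have m3: "b \<le> m"
    using m_ge[OF inF(3)] fin unfolding S3_def b_def
    by (simp only: sum_mycielskian finite.emptyI) simp
  have "a / x \<le> (\<Sum>v\<in>A. w (original v))"
    using A(2) x by (simp add: divide_le_eq mult.commute)
  then have "a / x + w 0 \<le> m" using m1 by linarith
  moreover have "(a + b) / x \<le> (\<Sum>v\<in>B. w (original v) + w (twin v))"
    using B(2) x by (simp add: divide_le_eq mult.commute)
  then have "(x - 1) * ((a + b) / x) \<le> (x - 1) * m"
    using m2 x by (intro mult_left_mono) linarith+
  moreover have "b / x \<le> m / x"
    using m3 x by (intro divide_right_mono) auto
  ultimately have "a / x + w 0 + (x - 1) * ((a + b) / x) + b / x \<le> m + (x - 1) * m + m / x"
    by linarith
  moreover have "a / x + w 0 + (x - 1) * ((a + b) / x) + b / x = w 0 + a + b"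
    using x by (simp add: field_simps)
  moreover have "m + (x - 1) * m + m / x = (x + 1 / x) * m"
    using x by (simp add: field_simps)
  moreover have "sum w (pverts ?M) = w 0 + a + b"
    using fin by (simp only: pverts_mycielskian sum_mycielskian a_def b_def)
  ultimately have "sum w (pverts ?M) \<le> (x + 1 / x) * sum w S"
    using S(2) by simp
  then show "\<exists>S. independent_in ?M S \<and> sum w (pverts ?M) \<le> (x + 1 / x) * sum w S"
    using S(1) by (auto simp: F_def)
qed

text \<open>
  The vertex 0, the originals and the twins get the weights \<open>1 / x\<close>, \<open>(1 - 1 / x) * w v\<close> and
  \<open>w v / x\<close>. For an independent set consisting of originals over \<open>A\<close> and twins over \<open>B\<close>, the
  fractional colouring is applied to the restriction of \<open>w\<close> to \<open>B - A\<close>: it yields an independent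
  subset of \<open>B - A\<close> with at least \<open>1 / x\<close> of its weight, and this subset can be added to \<open>A\<close>.
\<close>

lemma fractional_clique_mycielskian:
  assumes G: "pair_graph G" and x: "1 \<le> x" and col: "fractionally_colourable G x"
    and clique: "fractional_clique G x"
  shows "fractional_clique (mycielskian G) (x + 1 / x)"
proof -
  let ?V = "pverts G"
  obtain w where w: "\<And>v. 0 \<le> w v" "sum w ?V = x" "\<And>S. independent_in G S \<Longrightarrow> sum w S \<le> 1"
    using clique unfolding fractional_clique_def by blast
  have fin: "finite ?V" and sy: "sym (parcs G)" using G by (simp_all add: pair_graph_iff)
  \<comment> \<open>An odd \<open>n\<close> is the original of \<open>n div 2\<close>, a positive
    even \<open>n\<close> the twin of \<open>n div 2 - 1\<close>.\<close>
  define w' where "w' n = (if n = 0 then 1 / x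
    else if odd n then (1 - 1 / x) * w (n div 2) else w (n div 2 - 1) / x)" for n
  have w': "w' 0 = 1 / x" "w' (original v) = (1 - 1 / x) * w v" "w' (twin v) = w v / x" for v
    by (simp_all add: w'_def original_def twin_def)
  have "0 \<le> w' n" for n
    using w(1) x by (simp add: w'_def)
  moreover have "sum w' (pverts (mycielskian G)) = 1 / x + (1 - 1 / x) * sum w ?V + sum w ?V / x"
    using fin
    by (simp only: pverts_mycielskian sum_mycielskian w' sum_distrib_left sum_divide_distrib)
  then have "sum w' (pverts (mycielskian G)) = x + 1 / x"
    unfolding w(2) using x by (simp add: field_simps)
  moreover have "sum w' S \<le> 1" if S: "independent_in (mycielskian G) S" for S
  proof -
    define A where "A = {v \<in> ?V. original v \<in> S}"
    define B where "B = {v \<in> ?V. twin v \<in> S}"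
    have finAB: "finite A" "finite B" using fin by (simp_all add: A_def B_def)
    have SE: "(m, n) \<notin> parcs (mycielskian G)" if "m \<in> S" "n \<in> S" for m n
      using S that by (simp add: independent_in_def)
    have "(u, v) \<notin> parcs G" if "u \<in> A" "v \<in> A" for u v
      using SE[of "original u" "original v"] that by (simp add: A_def)
    then have A: "independent_in G A" by (auto simp: independent_in_def A_def)
    \<comment> \<open>An original is adjacent to the twins of its neighbours. Hence \<open>G\<close>
      has no arcs between \<open>A\<close> and \<open>B\<close>, and an independent subset of
      \<open>B\<close> can be joined to \<open>A\<close>.\<close>
    have AB: "(u, v) \<notin> parcs G" if "u \<in> A" "v \<in> B" for u v
      using SE[of "original u" "twin v"] that by (simp add: A_def B_def)
    have S_eq: "S - {0} = original ` A \<union> twin ` B"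
      using S by (auto simp: independent_in_def pverts_mycielskian A_def B_def)
    show ?thesis
    proof (cases "0 \<in> S")
      case True
      then have "B = {}"
        by (auto simp: B_def dest: SE[OF True])
      with True S_eq have "S = insert 0 (original ` A \<union> twin ` {})" by auto
      then have "sum w' S = 1 / x + (1 - 1 / x) * sum w A"
        using finAB by (simp only: sum_mycielskian w' finite.emptyI) (simp add: sum_distrib_left)
      also have "\<dots> \<le> 1 / x + (1 - 1 / x) * 1"
        using w(3)[OF A] x by (intro add_left_mono mult_left_mono) auto
      finally show ?thesis by simp
    next
      case False
      define C where "C = B - A"
      obtain I where I: "independent_in G I"
        "(\<Sum>v\<in>?V. if v \<in> C then w v else 0) \<le> x * (\<Sum>v\<in>I. if v \<in> C then w v else 0)"
        using col w(1) unfolding fractionally_colourable_def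
        by (elim allE[of _ "\<lambda>v. if v \<in> C then w v else 0"]) auto
      have finI: "finite I" using I(1) fin by (auto simp: independent_in_def finite_subset)
      have "?V \<inter> C = C" by (auto simp: C_def B_def)
      then have C_le: "sum w C \<le> x * sum w (I \<inter> C)"
        using I(2) by (simp add: sum.inter_restrict[OF fin, of w C, symmetric]
            sum.inter_restrict[OF finI, of w C, symmetric])
      have "independent_in G (A \<union> I \<inter> C)"
        using A I(1) AB sy by (auto simp: independent_in_def C_def dest: symD)
      then have "sum w (A \<union> I \<inter> C) \<le> 1" by (rule w(3))
      then have "sum w (I \<inter> C) \<le> 1 - sum w A"
        using finAB finI by (subst (asm) sum.union_disjoint) (auto simp: C_def)
      then have "x * sum w (I \<inter> C) \<le> x * (1 - sum w A)"
        using x by (intro mult_left_mono) auto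
      moreover have "sum w B = sum w (B \<inter> A) + sum w C"
        using finAB sum.Int_Diff[of B w A] by (simp add: C_def)
      moreover have "sum w (B \<inter> A) \<le> sum w A"
        using finAB w(1) by (intro sum_mono2) auto
      ultimately have B_le: "sum w B \<le> sum w A + x * (1 - sum w A)"
        using C_le by linarith
      have "S = original ` A \<union> twin ` B" using False S_eq by auto
      then have "sum w' S = (1 - 1 / x) * sum w A + sum w B / x"
        using finAB by (simp add: sum_mycielskian w' sum_distrib_left sum_divide_distrib)
      also have "\<dots> \<le> (1 - 1 / x) * sum w A + (sum w A + x * (1 - sum w A)) / x"
        using B_le x by (intro add_left_mono divide_right_mono) auto
      also have "\<dots> = 1" using x by (simp add: field_simps)
      finally show ?thesis .
    qed
  qed
  ultimately show ?thesis unfolding fractional_clique_def by blast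
qed

text \<open>The same \<open>x\<close> is kept as lower and upper bound because the clique step of
  the Mycielskian relies on the colouring bound. The square grows by more than 2 per step, as
  \<open>(x + 1 / x)\<^sup>2 = x\<^sup>2 + 2 + 1 / x\<^sup>2\<close>.\<close>

lemma triangle_free_large_fractional_clique:
  "\<exists>G :: nat pair_pre_digraph. \<exists>x. pair_graph G \<and> triangle_free_on G (pverts G) \<and>
     colourable_on G (pverts G) (Suc n) \<and> 1 \<le> x \<and> real (2 * n + 1) \<le> x\<^sup>2 \<and>
     fractionally_colourable G x \<and> fractional_clique G x"
proof (induction n)
  case 0
  define G :: "nat pair_pre_digraph" where "G = \<lparr> pverts = {0}, parcs = {} \<rparr>"
  have "colourable_on G (pverts G) (Suc 0)"
    unfolding colourable_on_def by (intro exI[of _ "\<lambda>_. 0"]) (simp add: G_def)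
  moreover have "triangle_free_on G (pverts G)" by (simp add: triangle_free_on_def G_def)
  ultimately show ?case
    using single_vertex_graph[of "0 :: nat", folded G_def]
    by (intro exI[of _ G] exI[of _ 1]) simp
next
  case (Suc n)
  then obtain G :: "nat pair_pre_digraph" and x where G: "pair_graph G"
    "triangle_free_on G (pverts G)" "colourable_on G (pverts G) (Suc n)" "1 \<le> x"
    "real (2 * n + 1) \<le> x\<^sup>2" "fractionally_colourable G x" "fractional_clique G x"
    by blast
  have "(x + 1 / x)\<^sup>2 = x\<^sup>2 + 2 + (1 / x)\<^sup>2"
    using G(4) by (simp add: power2_eq_square field_simps)
  moreover have "real (2 * Suc n + 1) = real (2 * n + 1) + 2" by simp
  ultimately have "real (2 * Suc n + 1) \<le> (x + 1 / x)\<^sup>2"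
    using G(5) zero_le_power2[of "1 / x"] by linarith
  moreover have "1 \<le> x + 1 / x" using G(4) by (simp add: add_increasing2)
  ultimately show ?case
    using G pair_graph_mycielskian triangle_free_mycielskian colourable_mycielskian
      fractionally_colourable_mycielskian fractional_clique_mycielskian by blast
qed

section \<open>Lexicographic products\<close>

text \<open>Coding pairs by natural numbers keeps all powers of a graph in the vertex type of
  \<open>bull_class\<close>.\<close>

definition lex_fst :: "nat \<Rightarrow> nat" where "lex_fst x = fst (prod_decode x)"
definition lex_snd :: "nat \<Rightarrow> nat" where "lex_snd x = snd (prod_decode x)"

lemma lex_eqI: "lex_fst x = lex_fst y \<Longrightarrow> lex_snd x = lex_snd y \<Longrightarrow> x = y"
  unfolding lex_fst_def lex_snd_def by (metis prod.collapse prod_decode_inverse)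

lemma lex_fst_snd_encode [simp]:
  "lex_fst (prod_encode (a, b)) = a" "lex_snd (prod_encode (a, b)) = b"
  by (simp_all add: lex_fst_def lex_snd_def)

lemma prod_encode_lex [simp]: "prod_encode (lex_fst x, lex_snd x) = x"
  by (simp add: lex_fst_def lex_snd_def)

definition lexicographic_product ::
    "nat pair_pre_digraph \<Rightarrow> nat pair_pre_digraph \<Rightarrow> nat pair_pre_digraph" where
  "lexicographic_product G H =
     \<lparr> pverts = prod_encode ` (pverts G \<times> pverts H),
       parcs = {(x, y). x \<in> prod_encode ` (pverts G \<times> pverts H) \<and>
         y \<in> prod_encode ` (pverts G \<times> pverts H) \<and>
         ((lex_fst x, lex_fst y) \<in> parcs G \<or>
          lex_fst x = lex_fst y \<and> (lex_snd x, lex_snd y) \<in> parcs H)} \<rparr>"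

lemma pverts_lexicographic_product:
  "x \<in> pverts (lexicographic_product G H) \<longleftrightarrow> lex_fst x \<in> pverts G \<and> lex_snd x \<in> pverts H"
  by (auto simp: lexicographic_product_def image_iff) (metis prod_encode_lex)

lemma parcs_lexicographic_product:
  "(x, y) \<in> parcs (lexicographic_product G H) \<longleftrightarrow>
     x \<in> pverts (lexicographic_product G H) \<and> y \<in> pverts (lexicographic_product G H) \<and>
     ((lex_fst x, lex_fst y) \<in> parcs G \<or>
      lex_fst x = lex_fst y \<and> (lex_snd x, lex_snd y) \<in> parcs H)"
  by (simp add: lexicographic_product_def)

section \<open>Cliques, fractional cliques, bulls and colourings of products\<close>

lemma pair_graph_lexicographic_product:
  assumes "pair_graph G" "pair_graph H"
  shows "pair_graph (lexicographic_product G H)"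
proof -
  have "finite (pverts (lexicographic_product G H))"
    using assms by (simp add: lexicographic_product_def pair_graph_iff)
  then show ?thesis
    using assms unfolding pair_graph_iff
    by (auto simp: parcs_lexicographic_product irrefl_def intro!: symI dest: symD)
qed

text \<open>The first coordinates of a clique form a clique of \<open>G\<close>, and the second
  coordinates over each of them form a clique of \<open>H\<close>.\<close>

lemma card_clique_lexicographic_product:
  assumes G: "pair_graph G" and H: "pair_graph H"
    and le: "\<And>S. clique_in G S \<Longrightarrow> card S \<le> m" "\<And>S. clique_in H S \<Longrightarrow> card S \<le> n"
    and S: "clique_in (lexicographic_product G H) S"
  shows "card S \<le> m * n"
proof -
  define F where "F g = {x \<in> S. lex_fst x = g}" for g
  have "S \<subseteq> pverts (lexicographic_product G H)" using S by (simp add: clique_in_def)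
  then have finS: "finite S"
    using pair_graph_lexicographic_product[OF G H] by (auto simp: pair_graph_iff intro: finite_subset)
  have "card (F g) \<le> n" for g
  proof -
    have "clique_in H (lex_snd ` F g)"
      using S G by (fastforce simp: clique_in_def F_def pverts_lexicographic_product
          parcs_lexicographic_product pair_graph_iff irrefl_def)
    moreover have "inj_on lex_snd (F g)" by (auto simp: F_def inj_on_def intro: lex_eqI)
    ultimately show ?thesis using le(2) by (metis card_image)
  qed
  then have "(\<Sum>g\<in>lex_fst ` S. card (F g)) \<le> card (lex_fst ` S) * n"
    using sum_bounded_above[of "lex_fst ` S" "\<lambda>g. card (F g)" n] by simp
  moreover have "card S \<le> (\<Sum>g\<in>lex_fst ` S. card (F g))"
  proof -
    have "S = (\<Union>g\<in>lex_fst ` S. F g)" by (auto simp: F_def)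
    with finS show ?thesis by (metis card_UN_le finite_imageI)
  qed
  moreover have "clique_in G (lex_fst ` S)"
    using S
    by (fastforce simp: clique_in_def pverts_lexicographic_product parcs_lexicographic_product)
  then have "card (lex_fst ` S) * n \<le> m * n" by (intro mult_right_mono le) auto
  ultimately show ?thesis by linarith
qed

text \<open>Product weights work: in an independent set the fibre over \<open>g\<close> projects to
  an independent set of \<open>H\<close>, hence weighs at most \<open>w g\<close>, and the first
  coordinates are independent in \<open>G\<close>.\<close>

lemma fractional_clique_lexicographic_product:
  assumes G: "pair_graph G" and H: "pair_graph H"
    and clique: "fractional_clique G x" "fractional_clique H y"
  shows "fractional_clique (lexicographic_product G H) (x * y)"
proof -
  obtain w where w: "\<And>v. 0 \<le> w v" "sum w (pverts G) = x"
    "\<And>S. independent_in G S \<Longrightarrow> sum w S \<le> 1"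
    using clique(1) unfolding fractional_clique_def by blast
  obtain u where u: "\<And>v. 0 \<le> u v" "sum u (pverts H) = y"
    "\<And>S. independent_in H S \<Longrightarrow> sum u S \<le> 1"
    using clique(2) unfolding fractional_clique_def by blast
  define r where "r z = w (lex_fst z) * u (lex_snd z)" for z
  have "0 \<le> r z" for z using w(1) u(1) by (simp add: r_def)
  moreover have "sum r (pverts (lexicographic_product G H)) = x * y"
  proof -
    have "sum r (pverts (lexicographic_product G H)) = (\<Sum>(g, h)\<in>pverts G \<times> pverts H. w g * u h)"
      unfolding lexicographic_product_def
      by (auto simp: sum.reindex inj_on_def r_def intro!: sum.cong)
    then show ?thesis
      by (simp add: w(2)[symmetric] u(2)[symmetric] sum_product sum.cartesian_product)
  qed
  moreover have "sum r S \<le> 1" if S: "independent_in (lexicographic_product G H) S" for S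
  proof -
    define F where "F g = {x \<in> S. lex_fst x = g}" for g
    have "S \<subseteq> pverts (lexicographic_product G H)" using S by (simp add: independent_in_def)
    then have finS: "finite S"
      using pair_graph_lexicographic_product[OF G H] by (auto simp: pair_graph_iff intro: finite_subset)
    have F_le: "sum r (F g) \<le> w g" for g
    proof -
      have inj: "inj_on lex_snd (F g)" by (auto simp: F_def inj_on_def intro: lex_eqI)
      have "independent_in H (lex_snd ` F g)"
        using S
        by (auto simp: independent_in_def F_def pverts_lexicographic_product
            parcs_lexicographic_product subset_iff)
      then have "w g * sum u (lex_snd ` F g) \<le> w g * 1"
        using w(1) u(3) by (intro mult_left_mono) auto
      moreover have "sum r (F g) = w g * sum u (lex_snd ` F g)"
        by (simp add: sum.reindex[OF inj] sum_distrib_left) (simp add: F_def r_def)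
      ultimately show ?thesis by simp
    qed
    have "sum r S = (\<Sum>g\<in>lex_fst ` S. sum r (F g))"
      unfolding F_def using finS by (rule sum.image_gen)
    also have "\<dots> \<le> sum w (lex_fst ` S)" by (intro sum_mono F_le)
    also have "\<dots> \<le> 1"
      using S
      by (intro w(3)) (auto simp: independent_in_def pverts_lexicographic_product
          parcs_lexicographic_product subset_iff)
    finally show ?thesis .
  qed
  ultimately show ?thesis unfolding fractional_clique_def by blast
qed

text \<open>A bull in the product either lies in one fibre of \<open>lex_fst\<close>, giving a bull
  of \<open>H\<close>, or meets every fibre at most once, giving a bull of \<open>G\<close>.\<close>

lemma no_bull_lexicographic_product:
  assumes G: "pair_graph G" and H: "pair_graph H"
    and nb: "\<And>a b c d e. \<not> bull_at G a b c d e" "\<And>a b c d e. \<not> bull_at H a b c d e"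
  shows "\<not> bull_at (lexicographic_product G H) a b c d e"
proof
  assume bull: "bull_at (lexicographic_product G H) a b c d e"
  define E where "E u v \<longleftrightarrow> (u, v) \<in> parcs (lexicographic_product G H)" for u v
  let ?p = lex_fst
  have E_sym: "E u v \<longleftrightarrow> E v u" for u v
    using pair_graph_lexicographic_product[OF G H] by (auto simp: E_def pair_graph_iff dest: symD)
  have V: "{a, b, c, d, e} \<subseteq> pverts (lexicographic_product G H)"
    using bull by (auto simp: bull_at_def parcs_lexicographic_product)
  have irr: "(g, g) \<notin> parcs G" for g using G by (simp add: pair_graph_iff irrefl_def)
  have hom: "E u z \<longleftrightarrow> E v z"
    if "?p u = ?p v" "?p z \<noteq> ?p u" "{u, v} \<subseteq> pverts (lexicographic_product G H)" for u v z
    using that by (auto simp: E_def parcs_lexicographic_product)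
  have B: "E a b" "E b c" "E c d" "E e b" "E e c"
    "\<not> E a c" "\<not> E a d" "\<not> E b d" "\<not> E a e" "\<not> E d e"
    using bull by (simp_all add: bull_at_def E_def)
  show False
  proof (cases "?p a = ?p b \<and> ?p a = ?p c \<and> ?p a = ?p d \<and> ?p a = ?p e")
    case True
    then obtain g where "?p a = g" "?p b = g" "?p c = g" "?p d = g" "?p e = g" by simp
    then have "bull_at H (lex_snd a) (lex_snd b) (lex_snd c) (lex_snd d) (lex_snd e)"
      using bull V irr by (simp add: bull_at_def parcs_lexicographic_product)
    with nb show False by blast
  next
    case False
    \<comment> \<open>Contrapositive of \<open>hom\<close>: a vertex that distinguishes two members
      of a fibre belongs to that fibre.\<close>
    have step: "?p z = ?p u"
      if "?p u = ?p v" "E u z \<noteq> E v z" "u \<in> {a, b, c, d, e}" "v \<in> {a, b, c, d, e}" for u v z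
      using hom[of u v z] that V by auto
    have B': "E b a" "E c b" "E d c" "E b e" "E c e"
      "\<not> E c a" "\<not> E d a" "\<not> E d b" "\<not> E e a" "\<not> E e d"
      using B E_sym by blast+
    \<comment> \<open>every pair of vertices of a bull is distinguished by a third one\<close>
    have imp:
      "?p a = ?p b \<Longrightarrow> ?p c = ?p a" "?p a = ?p b \<Longrightarrow> ?p e = ?p a"
      "?p a = ?p c \<Longrightarrow> ?p d = ?p a" "?p a = ?p c \<Longrightarrow> ?p e = ?p a"
      "?p a = ?p d \<Longrightarrow> ?p b = ?p a" "?p a = ?p d \<Longrightarrow> ?p c = ?p a"
      "?p a = ?p e \<Longrightarrow> ?p c = ?p a" "?p b = ?p c \<Longrightarrow> ?p a = ?p b"
      "?p b = ?p c \<Longrightarrow> ?p d = ?p b" "?p b = ?p d \<Longrightarrow> ?p a = ?p b"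
      "?p b = ?p d \<Longrightarrow> ?p e = ?p b" "?p b = ?p e \<Longrightarrow> ?p a = ?p b"
      "?p c = ?p d \<Longrightarrow> ?p b = ?p c" "?p c = ?p d \<Longrightarrow> ?p e = ?p c"
      "?p c = ?p e \<Longrightarrow> ?p d = ?p c" "?p d = ?p e \<Longrightarrow> ?p b = ?p d"
      by (rule step, assumption, simp add: B B', simp, simp)+
    \<comment> \<open>Under \<open>imp\<close>, any single coincidence spreads until all five
      vertices share a fibre.\<close>
    have "?p a \<noteq> ?p b" "?p a \<noteq> ?p c" "?p a \<noteq> ?p d" "?p a \<noteq> ?p e" "?p b \<noteq> ?p c"
      "?p b \<noteq> ?p d" "?p b \<noteq> ?p e" "?p c \<noteq> ?p d" "?p c \<noteq> ?p e" "?p d \<noteq> ?p e"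
      using imp False by metis+
    then have "bull_at G (?p a) (?p b) (?p c) (?p d) (?p e)"
      using bull V by (simp add: bull_at_def parcs_lexicographic_product)
    with nb show False by blast
  qed
qed

text \<open>Let \<open>U\<close> be the projection of \<open>W\<close>. Over a vertex with a
  neighbour in \<open>U\<close> the fibre is independent and takes the colour of that vertex in
  \<open>G\<close>; over an isolated vertex of \<open>U\<close> the fibre is coloured as in
  \<open>H\<close>. No arc joins the two kinds of fibres, so the same \<open>t\<close> colours serve
  both.\<close>

lemma colourable_lexicographic_product:
  assumes G: "\<And>W. W \<subseteq> pverts G \<Longrightarrow> triangle_free_on G W \<Longrightarrow> colourable_on G W t"
    and H: "\<And>W. W \<subseteq> pverts H \<Longrightarrow> triangle_free_on H W \<Longrightarrow> colourable_on H W t"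
    and pg: "pair_graph G" "pair_graph H"
    and W: "W \<subseteq> pverts (lexicographic_product G H)"
    and free: "triangle_free_on (lexicographic_product G H) W"
  shows "colourable_on (lexicographic_product G H) W t"
proof -
  let ?L = "lexicographic_product G H"
  define U where "U = lex_fst ` W"
  have W': "lex_fst x \<in> pverts G" "lex_snd x \<in> pverts H" if "x \<in> W" for x
    using W that by (auto simp: pverts_lexicographic_product subset_iff)
  have arc: "(x, y) \<in> parcs ?L \<longleftrightarrow> (lex_fst x, lex_fst y) \<in> parcs G \<or>
      lex_fst x = lex_fst y \<and> (lex_snd x, lex_snd y) \<in> parcs H" if "x \<in> W" "y \<in> W" for x y
    using W that by (auto simp: parcs_lexicographic_product)
  have tri: "\<not> ((x, y) \<in> parcs ?L \<and> (y, z) \<in> parcs ?L \<and> (x, z) \<in> parcs ?L)"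
    if "x \<in> W" "y \<in> W" "z \<in> W" for x y z
    using free that unfolding triangle_free_on_def by blast
  have "triangle_free_on G U"
    unfolding triangle_free_on_def
  proof (intro ballI notI)
    fix a b c
    assume "a \<in> U" "b \<in> U" "c \<in> U"
      and abc: "(a, b) \<in> parcs G \<and> (b, c) \<in> parcs G \<and> (a, c) \<in> parcs G"
    then obtain x y z where "x \<in> W" "y \<in> W" "z \<in> W"
      "a = lex_fst x" "b = lex_fst y" "c = lex_fst z"
      unfolding U_def by (elim imageE) (rule that)
    with abc tri[of x y z] show False by (simp add: arc)
  qed
  moreover have "U \<subseteq> pverts G" using W' by (auto simp: U_def)
  ultimately obtain c where c: "c ` U \<subseteq> {..<t}"
    "\<And>u v. u \<in> U \<Longrightarrow> v \<in> U \<Longrightarrow> (u, v) \<in> parcs G \<Longrightarrow> c u \<noteq> c v"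
    using G unfolding colourable_on_def by meson
  define F where "F u = {x \<in> W. lex_fst x = u}" for u
  have "\<exists>d. d ` (lex_snd ` F u) \<subseteq> {..<t} \<and>
      (\<forall>h\<in>lex_snd ` F u. \<forall>k\<in>lex_snd ` F u. (h, k) \<in> parcs H \<longrightarrow> d h \<noteq> d k)" for u
  proof -
    have "triangle_free_on H (lex_snd ` F u)"
      unfolding triangle_free_on_def
    proof (intro ballI notI)
      fix a b c
      assume "a \<in> lex_snd ` F u" "b \<in> lex_snd ` F u" "c \<in> lex_snd ` F u"
        and abc: "(a, b) \<in> parcs H \<and> (b, c) \<in> parcs H \<and> (a, c) \<in> parcs H"
      then obtain x y z where "x \<in> F u" "y \<in> F u" "z \<in> F u"
        "a = lex_snd x" "b = lex_snd y" "c = lex_snd z"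
        by (elim imageE) (rule that)
      with abc tri[of x y z] show False by (simp add: arc F_def)
    qed
    moreover have "lex_snd ` F u \<subseteq> pverts H" using W' by (auto simp: F_def)
    ultimately show ?thesis using H unfolding colourable_on_def by blast
  qed
  then obtain d where d: "\<And>u. d u ` (lex_snd ` F u) \<subseteq> {..<t}"
    "\<And>u h k. h \<in> lex_snd ` F u \<Longrightarrow> k \<in> lex_snd ` F u \<Longrightarrow> (h, k) \<in> parcs H \<Longrightarrow> d u h \<noteq> d u k"
    by metis
  define isolated where "isolated u \<longleftrightarrow> (\<forall>v\<in>U. (u, v) \<notin> parcs G)" for u
  define col where "col x =
    (if isolated (lex_fst x) then d (lex_fst x) (lex_snd x) else c (lex_fst x))" for x
  have symG: "sym (parcs G)" using pg by (simp add: pair_graph_iff)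
  have FI: "lex_snd x \<in> lex_snd ` F (lex_fst x)" "lex_fst x \<in> U" if "x \<in> W" for x
    using that by (auto simp: F_def U_def)
  have "col x < t" if "x \<in> W" for x
    using c(1) d(1)[of "lex_fst x"] FI[OF that] by (auto simp: col_def image_subset_iff)
  moreover have "col x \<noteq> col y" if xy: "x \<in> W" "y \<in> W" "(x, y) \<in> parcs ?L" for x y
  proof (cases "(lex_fst x, lex_fst y) \<in> parcs G")
    case True
    then have "\<not> isolated (lex_fst x)" "\<not> isolated (lex_fst y)"
      using FI(2) xy symD[OF symG] unfolding isolated_def by blast+
    then show ?thesis using c(2) FI(2) xy True by (simp add: col_def)
  next
    case False
    then have eq: "lex_fst x = lex_fst y" "(lex_snd x, lex_snd y) \<in> parcs H"
      using arc xy by auto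
    have "isolated (lex_fst x)"
      unfolding isolated_def U_def
    proof (intro ballI notI)
      fix v
      assume "v \<in> lex_fst ` W" "(lex_fst x, v) \<in> parcs G"
      \<comment> \<open>A vertex \<open>z\<close> over a neighbour is adjacent to both ends of the
        arc inside the fibre, which closes a triangle in \<open>W\<close>.\<close>
      then obtain z where "z \<in> W" "(lex_fst x, lex_fst z) \<in> parcs G" by blast
      with eq xy tri[of x y z] show False by (simp add: arc)
    qed
    then show ?thesis
      using d(2)[of "lex_snd x" "lex_fst x" "lex_snd y"] FI[OF xy(1)] FI[OF xy(2)] eq
      by (simp add: col_def)
  qed
  ultimately show ?thesis
    unfolding colourable_on_def by (intro exI[of _ col]) auto
qed

text \<open>The induction multiplies by \<open>G\<close> from the left. It carries the vertex-set
  conditions, under which products are closed, and \<open>bull_classI\<close> turns them into class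
  membership at the end.\<close>

lemma lexicographic_power_in_bull_class:
  fixes G :: "nat pair_pre_digraph"
  assumes G: "pair_graph G" and free: "triangle_free_on G (pverts G)"
    and col: "colourable_on G (pverts G) t" and t: "1 \<le> t" and clique: "fractional_clique G x"
  shows "\<exists>L. pair_graph L \<and> L \<in> bull_class t \<and> (\<forall>S. clique_in L S \<longrightarrow> card S \<le> 2 ^ n) \<and>
    fractional_clique L (x ^ n)"
proof -
  have "\<exists>L :: nat pair_pre_digraph. pair_graph L \<and> (\<forall>a b c d e. \<not> bull_at L a b c d e) \<and>
    (\<forall>W\<subseteq>pverts L. triangle_free_on L W \<longrightarrow> colourable_on L W t) \<and>
    (\<forall>S. clique_in L S \<longrightarrow> card S \<le> 2 ^ n) \<and> fractional_clique L (x ^ n)"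
  proof (induction n)
    case 0
    define L :: "nat pair_pre_digraph" where "L = \<lparr> pverts = {0}, parcs = {} \<rparr>"
    have "colourable_on L W t" for W
      using t unfolding colourable_on_def by (intro exI[of _ "\<lambda>_. 0"]) (auto simp: L_def)
    moreover have "card S \<le> 1" if "clique_in L S" for S
      using that card_mono[of "{0}" S] by (simp add: clique_in_def L_def)
    ultimately show ?case
      using single_vertex_graph[of "0 :: nat", folded L_def]
      by (intro exI[of _ L]) (simp add: L_def bull_at_def)
  next
    case (Suc n)
    then obtain L :: "nat pair_pre_digraph" where L: "pair_graph L"
      "\<forall>a b c d e. \<not> bull_at L a b c d e"
      "\<forall>W\<subseteq>pverts L. triangle_free_on L W \<longrightarrow> colourable_on L W t"
      "\<forall>S. clique_in L S \<longrightarrow> card S \<le> 2 ^ n" "fractional_clique L (x ^ n)"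
      by (elim exE conjE) (rule that)
    obtain c where c: "c ` pverts G \<subseteq> {..<t}"
      "\<forall>u\<in>pverts G. \<forall>v\<in>pverts G. (u, v) \<in> parcs G \<longrightarrow> c u \<noteq> c v"
      using col unfolding colourable_on_def by (elim exE conjE)
    have colG: "colourable_on G W t" if "W \<subseteq> pverts G" for W
      unfolding colourable_on_def using c that by (intro exI[of _ c] conjI ballI) blast+
    \<comment> \<open>The vertices \<open>b\<close>, \<open>c\<close>, \<open>e\<close> of a bull
      form a triangle.\<close>
    have nbG: "\<not> bull_at G a b c d e" for a b c d e
    proof
      assume "bull_at G a b c d e"
      moreover from this have "b \<in> pverts G" "c \<in> pverts G" "e \<in> pverts G"
        using G unfolding bull_at_def pair_graph_iff by blast+
      ultimately show False using free unfolding bull_at_def triangle_free_on_def by blast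
    qed
    have cliqueG: "card S \<le> 2" if S: "clique_in G S" for S
    proof (rule ccontr)
      assume "\<not> card S \<le> 2"
      then obtain T where "T \<subseteq> S" "card T = 3"
        using obtain_subset_with_card_n[of 3 S] by force
      then obtain a b c where "{a, b, c} \<subseteq> S" "a \<noteq> b" "b \<noteq> c" "a \<noteq> c"
        by (auto simp: card_3_iff)
      with S have "a \<in> pverts G" "b \<in> pverts G" "c \<in> pverts G"
        "(a, b) \<in> parcs G" "(b, c) \<in> parcs G" "(a, c) \<in> parcs G"
        by (auto simp: clique_in_def)
      with free show False unfolding triangle_free_on_def by blast
    qed
    have "colourable_on (lexicographic_product G L) W t"
      if "W \<subseteq> pverts (lexicographic_product G L)"
        "triangle_free_on (lexicographic_product G L) W" for W
      using colourable_lexicographic_product[OF colG L(3)[rule_format] G L(1) that] by simp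
    moreover have "card S \<le> 2 ^ Suc n" if "clique_in (lexicographic_product G L) S" for S
      using card_clique_lexicographic_product[OF G L(1) cliqueG L(4)[rule_format] that] by simp
    ultimately show ?case
      using pair_graph_lexicographic_product[OF G L(1)]
        no_bull_lexicographic_product[OF G L(1) nbG L(2)[rule_format]]
        fractional_clique_lexicographic_product[OF G L(1) clique L(5)]
      by (intro exI[of _ "lexicographic_product G L"]) simp
  qed
  then show ?thesis using bull_classI by meson
qed

section \<open>The degree bound\<close>

text \<open>For \<open>y \<ge> 1\<close> each power is at most the top one, so the sum of the
  absolute values of the coefficients serves as \<open>C\<close>.\<close>

lemma poly_le_power_degree:
  fixes p :: "real poly"
  shows "\<exists>C. \<forall>y\<ge>1. poly p y \<le> C * y ^ degree p"
proof (intro exI allI impI)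
  fix y :: real
  assume y: "1 \<le> y"
  have "poly p y = (\<Sum>i\<le>degree p. coeff p i * y ^ i)" by (rule poly_altdef)
  also have "\<dots> \<le> (\<Sum>i\<le>degree p. \<bar>coeff p i\<bar> * y ^ degree p)"
    using y by (intro sum_mono mult_mono power_increasing) auto
  finally show "poly p y \<le> (\<Sum>i\<le>degree p. \<bar>coeff p i\<bar>) * y ^ degree p"
    by (simp add: sum_distrib_right)
qed

theorem theorem1p4:
  fixes t :: nat and f :: "nat \<Rightarrow> nat" and p :: "real poly"
  assumes "t \<ge> 2"
    and "polynomial_function f p"
    and "chi_bounding f (bull_class t)"
  shows "real (degree p) > 1 / 2 * log 2 (real t)"
proof (rule ccontr)
  assume "\<not> real (degree p) > 1 / 2 * log 2 (real t)"
  then have "2 * real (degree p) \<le> log 2 (real t)" by simp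
  then have "2 powr (2 * real (degree p)) \<le> real t"
    using assms(1) by (simp add: le_log_iff)
  then have deg: "(2 ^ degree p)\<^sup>2 \<le> real t"
    by (simp add: powr_realpow mult.commute flip: power_mult powr_powr)
  obtain G :: "nat pair_pre_digraph" and x where G: "pair_graph G"
    "triangle_free_on G (pverts G)" "colourable_on G (pverts G) t" "1 \<le> x"
    "real (2 * (t - 1) + 1) \<le> x\<^sup>2" "fractional_clique G x"
    using triangle_free_large_fractional_clique[of "t - 1"] assms(1) by auto
  \<comment> \<open>After \<open>t - 1\<close> Mycielski steps the square is at least
    \<open>2 * t - 1\<close>, which exceeds \<open>t\<close> because
    \<open>t \<ge> 2\<close>.\<close>
  have "real t < x\<^sup>2" using G(5) assms(1) by linarith
  with deg have "(2 ^ degree p)\<^sup>2 < x\<^sup>2" by linarith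
  then have less: "2 ^ degree p < x" by (rule power2_less_imp_less) (use G(4) in simp)
  obtain C where C: "\<And>y. 1 \<le> y \<Longrightarrow> poly p y \<le> C * y ^ degree p"
    using poly_le_power_degree by blast
  \<comment> \<open>The base exceeds 1, so a bound uniform in \<open>n\<close> is
    contradictory.\<close>
  have "(x / 2 ^ degree p) ^ n \<le> max C 0" for n
  proof -
    obtain L where L: "pair_graph L" "L \<in> bull_class t" "fractional_clique L (x ^ n)"
      "\<And>S. clique_in L S \<Longrightarrow> card S \<le> 2 ^ n"
      using lexicographic_power_in_bull_class[OF G(1-3) _ G(6), of n] assms(1) by auto
    \<comment> \<open>\<open>chi_bounding\<close> constrains only graphs with vertices; here the
      total weight \<open>x ^ n\<close> is positive.\<close>
    have "pverts L \<noteq> {}"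
    proof
      assume "pverts L = {}"
      with L(3) have "x ^ n = 0" by (auto simp: fractional_clique_def)
      with G(4) show False by simp
    qed
    let ?m = "clique_number L"
    have m: "1 \<le> ?m" "?m \<le> 2 ^ n"
      using clique_number_bounds[OF L(1) \<open>pverts L \<noteq> {}\<close> L(4)] by auto
    have "x ^ n \<le> chromatic_number L"
      by (rule fractional_clique_le_chromatic_number[OF L(1,3)])
    also have "\<dots> \<le> f ?m"
      using assms(3) L(2) \<open>pverts L \<noteq> {}\<close> by (simp add: chi_bounding_def)
    also have "real (f ?m) = poly p ?m"
      using assms(2) m(1) by (simp add: polynomial_function_def)
    also have "\<dots> \<le> C * real ?m ^ degree p"
      using m(1) by (intro C) simp
    \<comment> \<open>A nonnegative factor is required to replace the clique number by its upper
      bound, hence the maximum with 0.\<close>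
    also have "\<dots> \<le> max C 0 * (2 ^ n) ^ degree p"
      using of_nat_mono[OF m(2), where 'a = real] by (intro mult_mono power_mono) auto
    also have "\<dots> = max C 0 * (2 ^ degree p) ^ n"
      by (simp add: mult.commute flip: power_mult)
    finally show ?thesis by (simp add: power_divide divide_le_eq)
  qed
  moreover have "1 < x / 2 ^ degree p" using less by simp
  ultimately show False
    using real_arch_pow[of "x / 2 ^ degree p" "max C 0"] by (meson not_less)
qed

end
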